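(* Let $G$ be an OTD-admissible graph of order $n$ and let $k = \lceil \log_2 (n+1) \rceil \ge 3$. Then $\gamma^{\mathrm{OTD}}(G) = k$ if and only if $G$ can be obtained (up to isomorphism) from some graph $G^O(k) = (C \cup (V \setminus C), E)$ for which $G^O(k)[C]$ is OTD-admissible, by removing up to $2^{k-1}-1$ vertices of $V \setminus C$.
   Context: Graphs are finite, simple and undirected. For a graph $G=(V,E)$ and $v\in V$, $N(v)$ is the open neighborhood; $G[C]$ is the subgraph induced by $C$. Open twins are distinct non-adjacent vertices $u,v$ with $N(u)=N(v)$. A set $C\subseteq V$ is total-dominating if $N(v)\cap C\neq\emptyset$ for all $v\in V$, and open-separating if $N(u)\cap C\neq N(v)\cap C$ for all distinct $u,v\in V$. An OTD-code is a set that is both open-separating and total-dominating. A graph is OTD-admissible if it has an OTD-code (equivalently, it has neither isolated vertices nor open twins); $\gamma^{\mathrm{OTD}}(G)$ is the minimum cardinality of an OTD-code of $G$. For $k\ge 2$, $G^O(k)$ denotes any graph with vertex set $V$ and a subset $C\subseteq V$ such that $|C|=k$, the induced subgraph $G^O(k)[C]$ has no open twins, and $V\setminus C$ consists of exactly one vertex $v_{C'}$ with $N(v_{C'})\cap C=C'$ for each non-empty subset $C'\subseteq C$ such that there is no vertex $u\in C$ with $N(u)\cap C=C'$; there is no condition on the edges inside $V\setminus C$. *)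

theory Defs
  imports Complex_Main "Graph_Theory.Digraph_Isomorphism"
begin

(* Finite simple undirected graphs are rendered by the locale predicate graph of the Graph_Theory
   library: finite, loop-free, symmetric digraphs without parallel arcs.  An undirected edge uv is
   the pair of arcs (u,v), (v,u). *)

definition nbhd :: "('a, 'b) pre_digraph \<Rightarrow> 'a \<Rightarrow> 'a set" where
  "nbhd G v = {u \<in> verts G. v \<rightarrow>\<^bsub>G\<^esub> u}"

definition open_twins :: "('a, 'b) pre_digraph \<Rightarrow> 'a \<Rightarrow> 'a \<Rightarrow> bool" where
  "open_twins G u v \<longleftrightarrow>
     u \<in> verts G \<and> v \<in> verts G \<and> u \<noteq> v \<and> \<not> u \<rightarrow>\<^bsub>G\<^esub> v \<and> nbhd G u = nbhd G v"

definition total_dominating :: "('a, 'b) pre_digraph \<Rightarrow> 'a set \<Rightarrow> bool" where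
  "total_dominating G C \<longleftrightarrow> C \<subseteq> verts G \<and> (\<forall>v\<in>verts G. nbhd G v \<inter> C \<noteq> {})"

definition open_separating :: "('a, 'b) pre_digraph \<Rightarrow> 'a set \<Rightarrow> bool" where
  "open_separating G C \<longleftrightarrow> C \<subseteq> verts G \<and>
     (\<forall>u\<in>verts G. \<forall>v\<in>verts G. u \<noteq> v \<longrightarrow> nbhd G u \<inter> C \<noteq> nbhd G v \<inter> C)"

definition otd_code :: "('a, 'b) pre_digraph \<Rightarrow> 'a set \<Rightarrow> bool" where
  "otd_code G C \<longleftrightarrow> open_separating G C \<and> total_dominating G C"

definition otd_admissible :: "('a, 'b) pre_digraph \<Rightarrow> bool" where
  "otd_admissible G \<longleftrightarrow> (\<exists>C. otd_code G C)"

(* Meaningful for OTD-admissible finite graphs only: otherwise Min is taken over the empty set. *)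
definition otd_number :: "('a, 'b) pre_digraph \<Rightarrow> nat" where
  "otd_number G = Min (card ` {C. otd_code G C})"

(* The bijection says that the vertices outside C are exactly one vertex with trace C' on C for
   each non-empty C' that is not already the trace of a vertex of C; edges outside C are free. *)
definition is_GO :: "nat \<Rightarrow> ('a, 'b) pre_digraph \<Rightarrow> 'a set \<Rightarrow> bool" where
  "is_GO k H C \<longleftrightarrow>
     graph H \<and> k \<ge> 2 \<and> C \<subseteq> verts H \<and> card C = k \<and>
     (\<nexists>u v. open_twins (H \<restriction> C) u v) \<and>
     bij_betw (\<lambda>v. nbhd H v \<inter> C) (verts H - C)
       {C'. C' \<subseteq> C \<and> C' \<noteq> {} \<and> (\<nexists>u. u \<in> C \<and> nbhd H u \<inter> C = C')}"

end

theory Submission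
  imports Defs
begin

(* An OTD-code C assigns to the vertices pairwise distinct non-empty traces N(v) \<inter> C, so there are
   fewer than 2^|C| vertices and k is a lower bound for the OTD-number. An OTD-code of size k
   therefore exists iff the number is k. Adding to G one vertex for every non-empty subset of such
   a code that is not yet a trace, with this subset as its neighbourhood, yields a graph G^O(k) of
   order 2^k - 1 \<le> (2^(k-1) - 1) + n. Conversely, C is an OTD-code of G^O(k) as soon as the
   graph induced by C is OTD-admissible, and it stays one when vertices outside C are removed. *)

section \<open>OTD-codes, traces and the counting bound\<close>

text \<open>Phrases separation as injectivity of the trace map
  \<open>v \<mapsto> nbhd G v \<inter> C\<close>, so that facts on \<open>inj_on\<close> and
  cardinalities of images apply.\<close>

lemma otd_code_iff:
  "otd_code G C \<longleftrightarrow> C \<subseteq> verts G \<and> inj_on (\<lambda>v. nbhd G v \<inter> C) (verts G) \<and>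
     (\<forall>v\<in>verts G. nbhd G v \<inter> C \<noteq> {})"
  unfolding otd_code_def open_separating_def total_dominating_def inj_on_def by blast

text \<open>The trace on \<open>D\<close> determines the trace on the smaller set \<open>C\<close>,
  so a larger set separates and dominates at least as well.\<close>

lemma otd_code_mono:
  assumes "otd_code G C" "C \<subseteq> D" "D \<subseteq> verts G"
  shows "otd_code G D"
proof -
  have "u = v" if "nbhd G u \<inter> D = nbhd G v \<inter> D" "u \<in> verts G" "v \<in> verts G" for u v
  proof -
    have "nbhd G u \<inter> C = nbhd G v \<inter> C" using that(1) assms(2) by blast
    then show ?thesis using that assms(1) by (auto simp: otd_code_iff dest: inj_onD)
  qed
  then show ?thesis using assms by (fastforce simp: otd_code_iff inj_on_def)
qed

lemma card_verts_less_two_power_otd_code: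
  assumes "finite (verts G)" "otd_code G C"
  shows "card (verts G) < 2 ^ card C"
proof -
  have C: "C \<subseteq> verts G" and inj: "inj_on (\<lambda>v. nbhd G v \<inter> C) (verts G)"
    and ne: "\<forall>v\<in>verts G. nbhd G v \<inter> C \<noteq> {}"
    using assms(2) by (auto simp: otd_code_iff)
  have "finite C" using C assms(1) finite_subset by blast
  have "{} \<notin> (\<lambda>v. nbhd G v \<inter> C) ` verts G" using ne by force
  then have sub: "(\<lambda>v. nbhd G v \<inter> C) ` verts G \<subset> Pow C" by blast
  have "card (verts G) = card ((\<lambda>v. nbhd G v \<inter> C) ` verts G)"
    using inj by (simp add: card_image)
  also have "\<dots> < card (Pow C)"
    using sub \<open>finite C\<close> by (intro psubset_card_mono) auto
  finally show ?thesis using \<open>finite C\<close> by (simp add: card_Pow)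
qed

section \<open>Induced subgraphs and isomorphisms\<close>

lemma dominates_induce_iff: "u \<rightarrow>\<^bsub>G \<restriction> S\<^esub> v \<longleftrightarrow> u \<rightarrow>\<^bsub>G\<^esub> v \<and> u \<in> S \<and> v \<in> S"
  by (auto simp: arcs_ends_conv)

lemma nbhd_induce:
  assumes "S \<subseteq> verts G" "v \<in> S"
  shows "nbhd (G \<restriction> S) v = nbhd G v \<inter> S"
  using assms by (auto simp: nbhd_def dominates_induce_iff)

text \<open>Deleting vertices outside the code leaves the traces of the remaining vertices
  unchanged. It serves both for removing \<open>R\<close> and, with \<open>S = C\<close>, for the
  subgraph induced by the code.\<close>

lemma otd_code_induce:
  assumes "otd_code G C" "C \<subseteq> S" "S \<subseteq> verts G"
  shows "otd_code (G \<restriction> S) C"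
proof -
  have eq: "nbhd (G \<restriction> S) v \<inter> C = nbhd G v \<inter> C" if "v \<in> S" for v
    using that assms by (auto simp: nbhd_induce)
  have "inj_on (\<lambda>v. nbhd G v \<inter> C) S"
    using assms by (auto simp: otd_code_iff intro: inj_on_subset)
  then have "inj_on (\<lambda>v. nbhd (G \<restriction> S) v \<inter> C) S"
    using eq by (simp cong: inj_on_cong)
  then show ?thesis using assms eq by (auto simp: otd_code_iff)
qed

text \<open>An isomorphism of digraphs also carries maps on arcs; codes depend only on its vertex
  bijection and on adjacency.\<close>

lemma digraph_iso_dominatesE:
  assumes "wf_digraph G" "digraph_iso G K"
  obtains f where "bij_betw f (verts G) (verts K)"
    "\<And>u v. u \<in> verts G \<Longrightarrow> v \<in> verts G \<Longrightarrow> f u \<rightarrow>\<^bsub>K\<^esub> f v \<longleftrightarrow> u \<rightarrow>\<^bsub>G\<^esub> v"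
proof -
  from assms(2) obtain h where h: "pre_digraph.digraph_isomorphism G h" and K: "K = app_iso h G"
    by (auto simp: digraph_iso_def)
  have inj: "inj_on (iso_verts h) (verts G)"
    using h by (rule pre_digraph.digraph_isomorphism_inj_on_verts)
  show ?thesis
  proof (rule that[of "iso_verts h"])
    show "bij_betw (iso_verts h) (verts G) (verts K)"
      using inj K by (simp add: bij_betw_def)
  next
    fix u v assume uv: "u \<in> verts G" "v \<in> verts G"
    show "iso_verts h u \<rightarrow>\<^bsub>K\<^esub> iso_verts h v \<longleftrightarrow> u \<rightarrow>\<^bsub>G\<^esub> v"
      unfolding K wf_digraph.arcs_ends_app_iso_eq[OF assms(1) h]
      using uv wf_digraph.adj_in_verts[OF assms(1)] inj by (force simp: inj_on_eq_iff)
  qed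
qed

lemma otd_code_iso:
  assumes bij: "bij_betw f (verts G) (verts K)"
    and adj: "\<And>u v. u \<in> verts G \<Longrightarrow> v \<in> verts G \<Longrightarrow> f u \<rightarrow>\<^bsub>K\<^esub> f v \<longleftrightarrow> u \<rightarrow>\<^bsub>G\<^esub> v"
    and C: "C \<subseteq> verts G"
  shows "otd_code K (f ` C) \<longleftrightarrow> otd_code G C"
proof -
  have inj: "inj_on f (verts G)" and K: "verts K = f ` verts G"
    using bij by (auto simp: bij_betw_def)
  have nb: "nbhd K (f v) \<inter> f ` C = f ` (nbhd G v \<inter> C)" if "v \<in> verts G" for v
    using that C adj by (auto simp: nbhd_def K)
  have eq: "f ` (nbhd G u \<inter> C) = f ` (nbhd G v \<inter> C) \<longleftrightarrow> nbhd G u \<inter> C = nbhd G v \<inter> C" for u v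
    using C by (intro inj_on_image_eq_iff[OF inj]) auto
  have "f ` C \<subseteq> verts K" using C K by blast
  moreover have "inj_on (\<lambda>v. nbhd K v \<inter> f ` C) (verts K) \<longleftrightarrow>
      inj_on (\<lambda>v. nbhd G v \<inter> C) (verts G)"
    unfolding K using inj by (auto simp: inj_on_def nb eq)
  moreover have "(\<forall>v\<in>verts K. nbhd K v \<inter> f ` C \<noteq> {}) \<longleftrightarrow> (\<forall>v\<in>verts G. nbhd G v \<inter> C \<noteq> {})"
    unfolding K by (simp add: nb)
  ultimately show ?thesis using C unfolding otd_code_iff by blast
qed

section \<open>Codes of the graphs G^O(k)\<close>

text \<open>Admissibility makes the traces of vertices in \<open>C\<close> distinct and non-empty.
  The bijection does this for the vertices outside, and its target excludes the traces already taken
  inside \<open>C\<close>.\<close>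

lemma otd_code_if_is_GO:
  assumes GO: "is_GO k H C" and adm: "otd_admissible (H \<restriction> C)"
  shows "otd_code H C"
proof -
  have C: "C \<subseteq> verts H"
    and bij: "bij_betw (\<lambda>v. nbhd H v \<inter> C) (verts H - C)
       {C'. C' \<subseteq> C \<and> C' \<noteq> {} \<and> (\<nexists>u. u \<in> C \<and> nbhd H u \<inter> C = C')}"
    using GO by (auto simp: is_GO_def)
  obtain D where D: "otd_code (H \<restriction> C) D" using adm by (auto simp: otd_admissible_def)
  \<comment> \<open>The code \<open>D\<close> given by admissibility may be a proper subset of
    \<open>C\<close>; enlarging it to \<open>C\<close> yields the traces that \<open>is_GO\<close>
    speaks of.\<close>
  then have "otd_code (H \<restriction> C) C" by (rule otd_code_mono) (use D in \<open>auto simp: otd_code_iff\<close>)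
  then have inj: "inj_on (\<lambda>v. nbhd H v \<inter> C) C" and ne: "\<forall>v\<in>C. nbhd H v \<inter> C \<noteq> {}"
    using C by (auto simp: otd_code_iff inj_on_def nbhd_induce)
  have out: "nbhd H v \<inter> C \<noteq> {} \<and> (\<forall>u\<in>C. nbhd H u \<inter> C \<noteq> nbhd H v \<inter> C)"
    if "v \<in> verts H - C" for v
    using bij_betwE[OF bij] that by blast
  have "inj_on (\<lambda>v. nbhd H v \<inter> C) (C \<union> (verts H - C))"
    unfolding inj_on_Un using inj bij_betw_imp_inj_on[OF bij] out by blast
  then have "inj_on (\<lambda>v. nbhd H v \<inter> C) (verts H)"
    using C by (simp add: Un_absorb1)
  then show ?thesis using C ne out by (auto simp: otd_code_iff)
qed

text \<open>A non-empty subset of \<open>C\<close> that is no trace from inside \<open>C\<close>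
  must, by \<open>full\<close>, come from outside, and from only one vertex by separation. Open
  twins in the subgraph induced by \<open>C\<close> would share a trace.\<close>

lemma is_GO_if_otd_code:
  assumes "graph H" "2 \<le> k" "card C = k" and code: "otd_code H C"
    and full: "\<And>S. S \<subseteq> C \<Longrightarrow> S \<noteq> {} \<Longrightarrow> \<exists>v\<in>verts H. nbhd H v \<inter> C = S"
  shows "is_GO k H C"
proof -
  have C: "C \<subseteq> verts H" and inj: "inj_on (\<lambda>v. nbhd H v \<inter> C) (verts H)"
    and ne: "\<forall>v\<in>verts H. nbhd H v \<inter> C \<noteq> {}"
    using code by (auto simp: otd_code_iff)
  have "otd_code (H \<restriction> C) C" using code C by (intro otd_code_induce) auto
  then have "\<nexists>u v. open_twins (H \<restriction> C) u v"
    by (auto simp: open_twins_def otd_code_iff inj_on_def)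
  moreover have "bij_betw (\<lambda>v. nbhd H v \<inter> C) (verts H - C)
       {C'. C' \<subseteq> C \<and> C' \<noteq> {} \<and> (\<nexists>u. u \<in> C \<and> nbhd H u \<inter> C = C')}" (is "bij_betw ?t _ ?M")
    unfolding bij_betw_def
  proof (intro conjI equalityI subsetI)
    show "inj_on ?t (verts H - C)" using inj by (rule inj_on_subset) blast
    show "S \<in> ?M" if "S \<in> ?t ` (verts H - C)" for S
      using that ne C inj by (auto dest: inj_onD)
    show "S \<in> ?t ` (verts H - C)" if "S \<in> ?M" for S
      using that full[of S] by blast
  qed
  ultimately show ?thesis using assms C by (simp add: is_GO_def)
qed

section \<open>Graphs given by a relation, and the extension of G\<close>

text \<open>Taking vertex pairs as arcs rules out parallel arcs, and restricting the vertex set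
  again gives a graph of this form for the same \<open>E\<close>.\<close>

definition graph_of_rel :: "'a set \<Rightarrow> ('a \<Rightarrow> 'a \<Rightarrow> bool) \<Rightarrow> ('a, 'a \<times> 'a) pre_digraph" where
  "graph_of_rel V E =
     \<lparr>verts = V, arcs = {(x, y). x \<in> V \<and> y \<in> V \<and> E x y}, tail = fst, head = snd\<rparr>"

lemma verts_graph_of_rel [simp]: "verts (graph_of_rel V E) = V"
  by (simp add: graph_of_rel_def)

lemma dominates_graph_of_rel [simp]:
  "x \<rightarrow>\<^bsub>graph_of_rel V E\<^esub> y \<longleftrightarrow> x \<in> V \<and> y \<in> V \<and> E x y"
  by (force simp: graph_of_rel_def arcs_ends_conv)

lemma graph_graph_of_rel:
  assumes "finite V" "\<And>x. \<not> E x x" "\<And>x y. E x y \<Longrightarrow> E y x"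
  shows "graph (graph_of_rel V E)"
proof -
  have "finite {(x, y). x \<in> V \<and> y \<in> V \<and> E x y}"
    by (rule finite_subset[of _ "V \<times> V"]) (use assms(1) in auto)
  moreover have "symmetric (graph_of_rel V E)"
    unfolding symmetric_def sym_def using assms(3) by auto
  ultimately show ?thesis
    using assms by unfold_locales (auto simp: graph_of_rel_def arc_to_ends_def)
qed

lemma induce_graph_of_rel: "S \<subseteq> V \<Longrightarrow> graph_of_rel V E \<restriction> S = graph_of_rel S E"
  by (auto simp: graph_of_rel_def induce_subgraph_def)

text \<open>Each arc is sent to the pair of images of its ends; this is injective because
  \<open>G\<close> has no parallel arcs.\<close>

lemma digraph_iso_graph_of_rel:
  assumes "nomulti_digraph G" and inj: "inj_on f (verts G)"
    and adj: "\<And>u v. u \<in> verts G \<Longrightarrow> v \<in> verts G \<Longrightarrow> E (f u) (f v) \<longleftrightarrow> u \<rightarrow>\<^bsub>G\<^esub> v"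
  shows "digraph_iso G (graph_of_rel (f ` verts G) E)"
proof -
  interpret nomulti_digraph G by fact
  define h where "h = \<lparr>iso_verts = f, iso_arcs = (\<lambda>e. (f (tail G e), f (head G e))),
    iso_head = snd, iso_tail = fst\<rparr>"
  have "inj_on (\<lambda>e. (f (tail G e), f (head G e))) (arcs G)"
  proof (rule inj_onI)
    fix e e' assume e: "e \<in> arcs G" "e' \<in> arcs G"
      "(f (tail G e), f (head G e)) = (f (tail G e'), f (head G e'))"
    then have "arc_to_ends G e = arc_to_ends G e'"
      using inj by (auto simp: arc_to_ends_def dest: inj_onD)
    then show "e = e'" using e no_multi_arcs by blast
  qed
  then have "digraph_isomorphism h"
    unfolding digraph_isomorphism_def h_def using inj wf_digraph by simp
  moreover have "{(x, y). x \<in> f ` verts G \<and> y \<in> f ` verts G \<and> E x y}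
      = (\<lambda>e. (f (tail G e), f (head G e))) ` arcs G"
    using adj adj_in_verts by (force simp: arcs_ends_conv)
  then have "graph_of_rel (f ` verts G) E = app_iso h G"
    by (simp add: graph_of_rel_def app_iso_def h_def)
  ultimately show ?thesis unfolding digraph_iso_def by blast
qed

text \<open>\<open>R\<close> is the set of added vertices, so its size counts the non-empty subsets
  of \<open>C\<close> that are not traces in \<open>G\<close>, and deleting it leaves a copy of
  \<open>G\<close>.\<close>

lemma otd_code_extend_is_GO:
  fixes G :: "('a, 'b) pre_digraph"
  assumes "graph G" and code: "otd_code G C" and k: "2 \<le> k" "card C = k"
  obtains H :: "(nat, nat \<times> nat) pre_digraph" and D R
  where "is_GO k H D" "otd_admissible (H \<restriction> D)" "R \<subseteq> verts H - D"
    "card R = 2 ^ k - 1 - card (verts G)" "digraph_iso G (H \<restriction> (verts H - R))"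
proof -
  interpret graph G by fact
  define t where "t v = nbhd G v \<inter> C" for v
  have C: "C \<subseteq> verts G" and inj_t: "inj_on t (verts G)" and ne: "\<And>v. v \<in> verts G \<Longrightarrow> t v \<noteq> {}"
    using code by (auto simp: otd_code_iff t_def inj_on_def)
  have fin_C: "finite C" using C finite_verts finite_subset by blast
  define M where "M = Pow C - {{}} - t ` verts G"
  have fin_M: "finite M" using fin_C by (simp add: M_def)
  have MC: "S \<subseteq> C" "S \<noteq> {}" "S \<notin> t ` verts G" if "S \<in> M" for S
    using that by (auto simp: M_def)
  have M_verts: "u \<in> verts G" if "S \<in> M" "u \<in> S" for S u
    using that MC(1) C by blast
  have card_M: "card M = 2 ^ k - 1 - card (verts G)"
  proof -
    have "t ` verts G \<subseteq> Pow C - {{}}" using ne by (auto simp: t_def)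
    then show ?thesis
      unfolding M_def using fin_C k inj_t
      by (simp add: card_Diff_subset card_image card_Pow finite_subset)
  qed
  have "finite (Inl ` verts G \<union> Inr ` M)" using fin_M by simp
  \<comment> \<open>Old vertices (\<open>Inl\<close>) and missing subsets (\<open>Inr\<close>) are
    numbered together, since \<open>H\<close> must live on the natural numbers; \<open>f\<close> and
    \<open>g\<close> are the two halves of this numbering.\<close>
  then obtain h :: "'a + 'a set \<Rightarrow> nat" where h: "inj_on h (Inl ` verts G \<union> Inr ` M)"
    using finite_imp_inj_to_nat_seg by metis
  define f where "f v = h (Inl v)" for v
  define g where "g S = h (Inr S)" for S
  have f: "f u = f v \<longleftrightarrow> u = v" if "u \<in> verts G" "v \<in> verts G" for u v
    using h that by (auto simp: f_def inj_on_def)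
  have g: "g S = g T \<longleftrightarrow> S = T" if "S \<in> M" "T \<in> M" for S T
    using h that by (auto simp: g_def inj_on_def)
  have fg: "f u \<noteq> g S" "g S \<noteq> f u" if "u \<in> verts G" "S \<in> M" for u S
    using h that by (force simp: f_def g_def inj_on_def)+
  \<comment> \<open>The new vertex \<open>g S\<close> is joined exactly to the copies of the
    elements of \<open>S\<close>; new vertices are pairwise non-adjacent.\<close>
  define E where "E x y \<longleftrightarrow>
      (\<exists>u\<in>verts G. \<exists>v\<in>verts G. x = f u \<and> y = f v \<and> u \<rightarrow>\<^bsub>G\<^esub> v) \<or>
      (\<exists>S\<in>M. \<exists>u\<in>S. x = g S \<and> y = f u \<or> x = f u \<and> y = g S)" for x y
  have E_ff: "E (f u) (f v) \<longleftrightarrow> u \<rightarrow>\<^bsub>G\<^esub> v" if "u \<in> verts G" "v \<in> verts G" for u v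
    using that f fg by (auto simp: E_def)
  have E_gf: "E (g S) (f u) \<longleftrightarrow> u \<in> S" if Su: "S \<in> M" "u \<in> verts G" for S u
  proof
    \<comment> \<open>As \<open>g S\<close> is no value of \<open>f\<close> on vertices of
      \<open>G\<close>, this edge can only be one of those leaving a new vertex.\<close>
    assume "E (g S) (f u)"
    then obtain T w where "T \<in> M" "w \<in> T" "g S = g T" "f u = f w"
      using fg(2)[OF _ Su(1)] M_verts unfolding E_def by blast
    then show "u \<in> S" using Su f g M_verts by metis
  qed (use Su in \<open>auto simp: E_def\<close>)
  define H where "H = graph_of_rel (f ` verts G \<union> g ` M) E"
  define D where "D = f ` C"
  have "graph H" unfolding H_def
  proof (rule graph_graph_of_rel)
    show "finite (f ` verts G \<union> g ` M)" using fin_M by simp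
    show "\<not> E x x" for x
    proof
      assume "E x x"
      then consider u v where "u \<in> verts G" "v \<in> verts G" "f u = f v" "u \<rightarrow>\<^bsub>G\<^esub> v"
        | S u where "S \<in> M" "u \<in> S" "f u = g S"
        unfolding E_def by metis
      then show False
      proof cases
        case 1
        then show ?thesis using f adj_not_same by auto
      next
        case 2
        then show ?thesis using fg M_verts by metis
      qed
    qed
    show "E y x" if "E x y" for x y
    proof -
      have "v \<rightarrow>\<^bsub>G\<^esub> u" if "u \<rightarrow>\<^bsub>G\<^esub> v" for u v
        using that sym_arcs by (rule arcs_ends_symmetric[rotated])
      then show ?thesis using that unfolding E_def by metis
    qed
  qed
  have D: "D \<subseteq> verts H" "card D = k"
    using C k f by (auto simp: D_def H_def intro!: card_image inj_onI)
  have nb_f: "nbhd H (f u) \<inter> D = f ` t u" if "u \<in> verts G" for u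
    using that C E_ff by (auto simp: nbhd_def H_def D_def t_def)
  have nb_g: "nbhd H (g S) \<inter> D = f ` S" if "S \<in> M" for S
    using that C E_gf MC(1)[OF that] M_verts by (auto simp: nbhd_def H_def D_def)
  have f_img: "f ` S = f ` T \<longleftrightarrow> S = T" if "S \<subseteq> C" "T \<subseteq> C" for S T
    using that C f by (intro inj_on_image_eq_iff[of f "verts G"]) (auto simp: inj_on_def)
  have tC: "t u \<subseteq> C" for u by (simp add: t_def)
  have "inj_on (\<lambda>v. nbhd H v \<inter> D) (f ` verts G)"
    using inj_t f tC by (auto simp: inj_on_def nb_f f_img)
  moreover have "inj_on (\<lambda>v. nbhd H v \<inter> D) (g ` M)"
    using MC by (auto simp: inj_on_def nb_g f_img)
  moreover have "nbhd H x \<inter> D \<noteq> nbhd H y \<inter> D" if "x \<in> f ` verts G" "y \<in> g ` M" for x y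
    using that MC tC by (fastforce simp: nb_f nb_g f_img)
  ultimately have "inj_on (\<lambda>v. nbhd H v \<inter> D) (verts H)"
    unfolding H_def verts_graph_of_rel inj_on_Un by (fold H_def) blast
  moreover have "nbhd H v \<inter> D \<noteq> {}" if "v \<in> verts H" for v
  proof -
    from that consider u where "u \<in> verts G" "v = f u" | S where "S \<in> M" "v = g S"
      by (auto simp: H_def)
    then show ?thesis using ne MC(2) by cases (auto simp: nb_f nb_g)
  qed
  ultimately have code_H: "otd_code H D" using D by (auto simp: otd_code_iff)
  show ?thesis
  proof (rule that[of H D "g ` M"])
    show "is_GO k H D"
    proof (rule is_GO_if_otd_code[OF \<open>graph H\<close> k(1) D(2) code_H])
      fix S assume S: "S \<subseteq> D" "S \<noteq> {}"
      \<comment> \<open>Pulled back to \<open>C\<close>, the subset is either the trace of an old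
        vertex or a member of \<open>M\<close>, which has its own new vertex.\<close>
      then obtain T where T: "T \<subseteq> C" "S = f ` T" unfolding D_def by (auto simp: subset_image_iff)
      show "\<exists>v\<in>verts H. nbhd H v \<inter> D = S"
      proof (cases "T \<in> t ` verts G")
        case True
        then obtain u where "u \<in> verts G" "T = t u" by blast
        then show ?thesis using T nb_f by (intro bexI[of _ "f u"]) (auto simp: H_def)
      next
        case False
        then have "T \<in> M" using S T by (auto simp: M_def)
        then show ?thesis using T nb_g by (intro bexI[of _ "g T"]) (auto simp: H_def)
      qed
    qed
    have "otd_code (H \<restriction> D) D" using code_H D by (intro otd_code_induce) auto
    then show "otd_admissible (H \<restriction> D)" by (auto simp: otd_admissible_def)
    show "g ` M \<subseteq> verts H - D" using fg C by (auto simp: H_def D_def)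
    show "card (g ` M) = 2 ^ k - 1 - card (verts G)"
      using g card_M by (subst card_image) (auto simp: inj_on_def)
    have "verts H - g ` M = f ` verts G" using fg by (auto simp: H_def)
    then have "H \<restriction> (verts H - g ` M) = graph_of_rel (f ` verts G) E"
      by (simp add: H_def induce_graph_of_rel)
    moreover have "digraph_iso G (graph_of_rel (f ` verts G) E)"
      using f E_ff nomulti_digraph by (intro digraph_iso_graph_of_rel) (auto simp: inj_on_def)
    ultimately show "digraph_iso G (H \<restriction> (verts H - g ` M))" by simp
  qed
qed

section \<open>The OTD-number and the characterisation\<close>

text \<open>The bound \<open>lower\<close> forces every code to have at least \<open>k\<close>
  elements, so the minimum is \<open>k\<close> exactly when some code attains it.\<close>

lemma otd_number_eq_iff:
  assumes "finite (verts G)" "otd_admissible G"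
    and lower: "2 ^ (k - 1) \<le> card (verts G)"
  shows "otd_number G = k \<longleftrightarrow> (\<exists>C. otd_code G C \<and> card C = k)"
proof -
  let ?A = "card ` {C. otd_code G C}"
  have "finite {C. otd_code G C}"
    by (rule finite_subset[of _ "Pow (verts G)"]) (use assms(1) in \<open>auto simp: otd_code_iff\<close>)
  then have fin: "finite ?A" by simp
  have "?A \<noteq> {}" using assms(2) by (auto simp: otd_admissible_def)
  have "k \<le> card C" if "otd_code G C" for C
  proof -
    have "2 ^ (k - 1) < (2::nat) ^ card C"
      using lower card_verts_less_two_power_otd_code[OF assms(1) that] by linarith
    then have "k - 1 < card C" by simp
    then show ?thesis by linarith
  qed
  then show ?thesis
    unfolding otd_number_def using Min_in[OF fin \<open>?A \<noteq> {}\<close>] Min_eqI[OF fin, of k] by auto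
qed

theorem theorem5:
  fixes G :: "('a, 'b) pre_digraph" and n k :: nat
  assumes "graph G"
    and "otd_admissible G"
    and "n = card (verts G)"
    and "int k = \<lceil>log 2 (real n + 1)\<rceil>"
    and "k \<ge> 3"
  shows "otd_number G = k \<longleftrightarrow>
    (\<exists>(H :: (nat, nat \<times> nat) pre_digraph) C R.
       is_GO k H C \<and> otd_admissible (H \<restriction> C) \<and>
       R \<subseteq> verts H - C \<and> card R \<le> 2 ^ (k - 1) - 1 \<and>
       digraph_iso G (H \<restriction> (verts H - R)))"
proof -
  interpret graph G by fact
  \<comment> \<open>The ceiling exceeds its argument by less than 1; the resulting 2^(k-1) < n + 1
    becomes \<open>lower\<close> by integrality.\<close>
  have "real (k - 1) < log 2 (real n + 1)" using assms(4,5) by linarith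
  then have "2 powr real (k - 1) < real n + 1" by (simp add: less_log_iff)
  then have "2 ^ (k - 1) < real n + 1" by (simp add: powr_realpow)
  then have "real (2 ^ (k - 1)) < real (n + 1)" by simp
  then have lower: "2 ^ (k - 1) \<le> n" by linarith
  have "otd_number G = k \<longleftrightarrow> (\<exists>C. otd_code G C \<and> card C = k)"
    using assms(2,3) lower by (intro otd_number_eq_iff) auto
  also have "\<dots> \<longleftrightarrow> (\<exists>(H :: (nat, nat \<times> nat) pre_digraph) C R.
       is_GO k H C \<and> otd_admissible (H \<restriction> C) \<and>
       R \<subseteq> verts H - C \<and> card R \<le> 2 ^ (k - 1) - 1 \<and>
       digraph_iso G (H \<restriction> (verts H - R)))" (is "?L \<longleftrightarrow> ?R")
  proof
    assume ?L
    then obtain C where C: "otd_code G C" "card C = k" by blast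
    have "2 \<le> k" using assms(5) by simp
    then obtain H :: "(nat, nat \<times> nat) pre_digraph" and D R
      where H: "is_GO k H D" "otd_admissible (H \<restriction> D)" "R \<subseteq> verts H - D"
        "card R = 2 ^ k - 1 - n" "digraph_iso G (H \<restriction> (verts H - R))"
      using otd_code_extend_is_GO[OF assms(1) C(1) _ C(2)] assms(3) by metis
    \<comment> \<open>With n at least 2^(k-1), the 2^k - 1 - n added vertices number at most 2^(k-1)
      - 1.\<close>
    have "(2::nat) ^ k = 2 * 2 ^ (k - 1)" using assms(5) by (cases k) auto
    then have "card R \<le> 2 ^ (k - 1) - 1" using H(4) lower by linarith
    then show ?R using H by blast
  next
    assume ?R
    then obtain H :: "(nat, nat \<times> nat) pre_digraph" and C R
      where H: "is_GO k H C" "otd_admissible (H \<restriction> C)" "R \<subseteq> verts H - C"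
        and iso: "digraph_iso G (H \<restriction> (verts H - R))"
      by blast
    let ?K = "H \<restriction> (verts H - R)"
    have C: "C \<subseteq> verts H - R" "card C = k" using H by (auto simp: is_GO_def)
    have code: "otd_code ?K C"
      using otd_code_if_is_GO[OF H(1,2)] C(1) by (intro otd_code_induce) auto
    obtain f where f: "bij_betw f (verts G) (verts ?K)"
      "\<And>u v. u \<in> verts G \<Longrightarrow> v \<in> verts G \<Longrightarrow> f u \<rightarrow>\<^bsub>?K\<^esub> f v \<longleftrightarrow> u \<rightarrow>\<^bsub>G\<^esub> v"
      using digraph_iso_dominatesE[OF wf_digraph iso] by blast
    \<comment> \<open>\<open>C\<close> avoids \<open>R\<close> and so survives in \<open>?K\<close>;
      its preimage under \<open>f\<close> is the desired code of \<open>G\<close>.\<close>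
    obtain D where D: "D \<subseteq> verts G" "C = f ` D"
      using C(1) f(1) by (metis bij_betw_imp_surj_on induce_subgraph_verts subset_imageE)
    have "otd_code G D" using otd_code_iso[OF f D(1)] code D(2) by simp
    moreover have "card D = k"
      using C(2) D f(1) by (metis bij_betw_imp_inj_on card_image inj_on_subset)
    ultimately show ?L by blast
  qed
  finally show ?thesis .
qed

end
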